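(* Let $X=C_0(\mathbb R_+)=\{f\in C([0,\infty))\mid f(x)\to 0\text{ as }x\to\infty\}$ with the sup-norm, let $g(x)=\frac{\sin x}{x}$ (with $g(0)=1$), and let $\varphi_t: X\times\mathbb R^2\to X\times\mathbb R^2$, $t\ge 0$, be the semigroup $$\varphi_t\begin{pmatrix} f(x)\\ y\\ z\end{pmatrix}=\begin{pmatrix} f(x+t)+\int_0^t g(x+s)\,(y+(t-s)z)\,ds\\ y+tz\\ z\end{pmatrix}.$$ Then the subspace $Y=0\times\mathbb R^2\subset X\times\mathbb R^2$ is not almost stabilizable under the action of this semigroup.
   Context: The norm on $X\times\mathbb R^2$ is $\|(f,y,z)\|=\max_{x\ge 0}|f(x)|+\sqrt{y^2+z^2}$. Write $Y_t=\varphi_t(Y)$. A finite-dimensional subspace $Y$ is almost stabilizable if for each $t<\infty$ one has $\sup_{0\le s<t}\angle(Y_T,Y_{T+s})\to 0$ as $T\to\infty$. For subspaces $A,B$ of a Banach space the angle is $$\angle(A,B)=\min\Bigl\{\sup_{a\in A,\,|a|=1}\rho(a,B),\ \sup_{b\in B,\,|b|=1}\rho(b,A)\Bigr\},$$ where $\rho(v,A)$ denotes the distance from the vector $v$ to the subspace $A$. *)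

theory Defs
  imports "HOL-Analysis.Analysis" "HOL-Probability.Sinc_Integral"
begin

section \<open>The space of continuous functions on the half-line vanishing at infinity\<close>

text \<open>A function on \<open>[0, \<infinity>)\<close> is represented by its extension by zero to the negative half-axis;
  continuity is required on \<open>[0, \<infinity>)\<close> only.  This makes the representative of each element of
  \<open>C\<^sub>0([0, \<infinity>))\<close> unique.\<close>

typedef c0 = "{f :: real \<Rightarrow> real. continuous_on {0..} f \<and> (f \<longlongrightarrow> 0) at_top \<and> (\<forall>x<0. f x = 0)}"
  morphisms c0_apply Abs_c0
  by (rule exI[of _ "\<lambda>_. 0"]) auto

setup_lifting type_definition_c0

lemma c0_eqI: "(\<And>x. 0 \<le> x \<Longrightarrow> c0_apply f x = c0_apply g x) \<Longrightarrow> f = g"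
proof -
  assume eq: "\<And>x. 0 \<le> x \<Longrightarrow> c0_apply f x = c0_apply g x"
  have "c0_apply f x = c0_apply g x" for x
    using eq[of x] c0_apply[of f] c0_apply[of g] by (cases "0 \<le> x") auto
  then show "f = g"
    unfolding c0_apply_inject[symmetric] by (rule ext)
qed

lemma c0_bdd: "bdd_above ((\<lambda>x. \<bar>c0_apply f x\<bar>) ` {0..})"
proof (transfer)
  fix f :: "real \<Rightarrow> real"
  assume f: "continuous_on {0..} f \<and> (f \<longlongrightarrow> 0) at_top \<and> (\<forall>x<0. f x = 0)"
  then have "eventually (\<lambda>x. \<bar>f x\<bar> < 1) at_top"
    using tendstoD[of f 0 at_top 1] by simp
  then obtain N where N: "\<And>x. N \<le> x \<Longrightarrow> \<bar>f x\<bar> < 1"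
    by (auto simp: eventually_at_top_linorder)
  have "compact (f ` {0..N})"
    using f continuous_on_subset[of "{0..}" f "{0..N}"] by (intro compact_continuous_image) auto
  then have "bounded (f ` {0..N})"
    by (rule compact_imp_bounded)
  then obtain B where "\<forall>v\<in>f ` {0..N}. norm v \<le> B"
    unfolding bounded_iff by (rule exE)
  then have B: "\<And>x. x \<in> {0..N} \<Longrightarrow> \<bar>f x\<bar> \<le> B"
    by simp
  show "bdd_above ((\<lambda>x. \<bar>f x\<bar>) ` {0..})"
  proof (rule bdd_aboveI2)
    fix x :: real assume "x \<in> {0..}"
    then show "\<bar>f x\<bar> \<le> max B 1"
      using N[of x] B[of x] by (cases "x \<le> N") (auto simp: max_def)
  qed
qed

instantiation c0 :: real_vector
begin

lift_definition zero_c0 :: c0 is "\<lambda>_. 0"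
  by auto

lift_definition uminus_c0 :: "c0 \<Rightarrow> c0" is "\<lambda>f x. - f x"
  by (auto intro!: continuous_intros tendsto_eq_intros)

lift_definition plus_c0 :: "c0 \<Rightarrow> c0 \<Rightarrow> c0" is "\<lambda>f g x. f x + g x"
  by (auto intro!: continuous_intros tendsto_eq_intros)

lift_definition minus_c0 :: "c0 \<Rightarrow> c0 \<Rightarrow> c0" is "\<lambda>f g x. f x - g x"
  by (auto intro!: continuous_intros tendsto_eq_intros)

lift_definition scaleR_c0 :: "real \<Rightarrow> c0 \<Rightarrow> c0" is "\<lambda>a f x. a * f x"
  by (auto intro!: continuous_intros tendsto_eq_intros)

instance
proof
  fix f g h :: c0 and a b :: real
  show "f + g + h = f + (g + h)" "f + g = g + f" "0 + f = f" "- f + f = 0" "f - g = f + - g"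
    "a *\<^sub>R (f + g) = a *\<^sub>R f + a *\<^sub>R g" "(a + b) *\<^sub>R f = a *\<^sub>R f + b *\<^sub>R f"
    "a *\<^sub>R b *\<^sub>R f = (a * b) *\<^sub>R f" "1 *\<^sub>R f = f"
    by (transfer; auto simp: algebra_simps)+
qed

end

instantiation c0 :: real_normed_vector
begin

definition norm_c0 :: "c0 \<Rightarrow> real" where
  "norm_c0 f = (SUP x\<in>{0..}. \<bar>c0_apply f x\<bar>)"

definition dist_c0 :: "c0 \<Rightarrow> c0 \<Rightarrow> real" where
  "dist_c0 f g = norm (f - g)"

definition sgn_c0 :: "c0 \<Rightarrow> c0" where
  "sgn_c0 f = f /\<^sub>R norm f"

definition uniformity_c0 :: "(c0 \<times> c0) filter" where
  "uniformity_c0 = (INF e\<in>{0 <..}. principal {(x, y). dist x y < e})"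

definition open_c0 :: "c0 set \<Rightarrow> bool" where
  "open_c0 S = (\<forall>x\<in>S. \<forall>\<^sub>F (x', y) in uniformity. x' = x \<longrightarrow> y \<in> S)"

instance
proof
  fix f g :: c0 and a :: real and S :: "c0 set"
  show "dist f g = norm (f - g)" "sgn f = f /\<^sub>R norm f"
    by (rule dist_c0_def sgn_c0_def)+
  show "uniformity = (INF e\<in>{0 <..}. principal {(x, y :: c0). dist x y < e})"
    by (rule uniformity_c0_def)
  show "open S = (\<forall>x\<in>S. \<forall>\<^sub>F (x', y) in uniformity. x' = x \<longrightarrow> y \<in> S)"
    by (rule open_c0_def)
  have le: "\<bar>c0_apply f x\<bar> \<le> norm f" if "0 \<le> x" for f :: c0 and x
    unfolding norm_c0_def using that by (intro cSUP_upper c0_bdd) auto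
  have least: "norm f \<le> b" if "\<And>x. 0 \<le> x \<Longrightarrow> \<bar>c0_apply f x\<bar> \<le> b" for f :: c0 and b
    unfolding norm_c0_def using that by (intro cSUP_least) auto
  show "(norm f = 0) = (f = 0)"
  proof
    assume "norm f = 0"
    then show "f = 0"
      using le[of _ f] by (intro c0_eqI) (auto simp: zero_c0.rep_eq)
  next
    assume "f = 0"
    then show "norm f = 0"
      by (simp add: norm_c0_def zero_c0.rep_eq)
  qed
  show "norm (f + g) \<le> norm f + norm g"
  proof (rule least)
    fix x :: real assume "0 \<le> x"
    then show "\<bar>c0_apply (f + g) x\<bar> \<le> norm f + norm g"
      using le[of x f] le[of x g] by (simp add: plus_c0.rep_eq)
  qed
  have scale: "norm (a *\<^sub>R f) \<le> \<bar>a\<bar> * norm f" for a and f :: c0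
  proof (rule least)
    fix x :: real assume "0 \<le> x"
    then show "\<bar>c0_apply (a *\<^sub>R f) x\<bar> \<le> \<bar>a\<bar> * norm f"
      unfolding scaleR_c0.rep_eq abs_mult by (intro mult_left_mono le abs_ge_zero)
  qed
  show "norm (a *\<^sub>R f) = \<bar>a\<bar> * norm f"
  proof (cases "a = 0")
    case True
    have "norm (0 :: c0) = 0"
      unfolding norm_c0_def by (simp add: zero_c0.rep_eq)
    then show ?thesis
      unfolding True by simp
  next
    case False
    have f: "inverse a *\<^sub>R a *\<^sub>R f = f"
      using False by (simp only: scaleR_scaleR left_inverse scaleR_one not_False_eq_True)
    have "\<bar>a\<bar> * norm f \<le> \<bar>a\<bar> * (\<bar>inverse a\<bar> * norm (a *\<^sub>R f))"
      using scale[of "inverse a" "a *\<^sub>R f"] unfolding f by (rule mult_left_mono) (rule abs_ge_zero)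
    also have "\<dots> = norm (a *\<^sub>R f)"
      using False by (simp only: mult.assoc[symmetric] abs_mult[symmetric] right_inverse abs_one mult_1_left not_False_eq_True)
    finally show ?thesis
      using scale[of a f] by (rule antisym[rotated])
  qed
qed

end

section \<open>The phase space\<close>

text \<open>A datatype is used instead of the product \<open>c0 \<times> real \<times> real\<close>, whose library norm is the
  Euclidean combination of the component norms rather than the norm \<open>\<parallel>f\<parallel> + sqrt (y\<^sup>2 + z\<^sup>2)\<close>.\<close>

datatype phase = Phase (fun_part: c0) (y_part: real) (z_part: real)

instantiation phase :: real_vector
begin

definition zero_phase :: phase where
  "0 = Phase 0 0 0"

definition uminus_phase :: "phase \<Rightarrow> phase" where
  "- u = Phase (- fun_part u) (- y_part u) (- z_part u)"

definition plus_phase :: "phase \<Rightarrow> phase \<Rightarrow> phase" where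
  "u + v = Phase (fun_part u + fun_part v) (y_part u + y_part v) (z_part u + z_part v)"

definition minus_phase :: "phase \<Rightarrow> phase \<Rightarrow> phase" where
  "u - v = Phase (fun_part u - fun_part v) (y_part u - y_part v) (z_part u - z_part v)"

definition scaleR_phase :: "real \<Rightarrow> phase \<Rightarrow> phase" where
  "a *\<^sub>R u = Phase (a *\<^sub>R fun_part u) (a * y_part u) (a * z_part u)"

instance
proof
  fix u v w :: phase and a b :: real
  note defs = zero_phase_def uminus_phase_def plus_phase_def minus_phase_def scaleR_phase_def
  show "u + v + w = u + (v + w)" "u + v = v + u" "0 + u = u" "- u + u = 0" "u - v = u + - v"
    "a *\<^sub>R (u + v) = a *\<^sub>R u + a *\<^sub>R v" "(a + b) *\<^sub>R u = a *\<^sub>R u + b *\<^sub>R u"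
    "a *\<^sub>R b *\<^sub>R u = (a * b) *\<^sub>R u" "1 *\<^sub>R u = u"
    by (simp_all add: defs algebra_simps)
qed

end

instantiation phase :: real_normed_vector
begin

definition norm_phase :: "phase \<Rightarrow> real" where
  "norm u = norm (fun_part u) + sqrt ((y_part u)\<^sup>2 + (z_part u)\<^sup>2)"

definition dist_phase :: "phase \<Rightarrow> phase \<Rightarrow> real" where
  "dist_phase u v = norm (u - v)"

definition sgn_phase :: "phase \<Rightarrow> phase" where
  "sgn_phase u = u /\<^sub>R norm u"

definition uniformity_phase :: "(phase \<times> phase) filter" where
  "uniformity_phase = (INF e\<in>{0 <..}. principal {(x, y). dist x y < e})"

definition open_phase :: "phase set \<Rightarrow> bool" where
  "open_phase S = (\<forall>x\<in>S. \<forall>\<^sub>F (x', y) in uniformity. x' = x \<longrightarrow> y \<in> S)"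

instance
proof
  fix u v :: phase and a :: real and S :: "phase set"
  show "dist u v = norm (u - v)" "sgn u = u /\<^sub>R norm u"
    by (rule dist_phase_def sgn_phase_def)+
  show "uniformity = (INF e\<in>{0 <..}. principal {(x, y :: phase). dist x y < e})"
    by (rule uniformity_phase_def)
  show "open S = (\<forall>x\<in>S. \<forall>\<^sub>F (x', y) in uniformity. x' = x \<longrightarrow> y \<in> S)"
    by (rule open_phase_def)
  show "(norm u = 0) = (u = 0)"
    by (cases u) (auto simp: norm_phase_def zero_phase_def add_nonneg_eq_0_iff sum_power2_eq_zero_iff)
  show "norm (u + v) \<le> norm u + norm v"
    using norm_triangle_ineq[of "fun_part u" "fun_part v"]
      real_sqrt_sum_squares_triangle_ineq[of "y_part u" "y_part v" "z_part u" "z_part v"]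
    by (simp add: norm_phase_def plus_phase_def)
  have "sqrt ((a * y_part u)\<^sup>2 + (a * z_part u)\<^sup>2) = \<bar>a\<bar> * sqrt ((y_part u)\<^sup>2 + (z_part u)\<^sup>2)"
    unfolding power_mult_distrib distrib_left[symmetric] real_sqrt_mult by simp
  then show "norm (a *\<^sub>R u) = \<bar>a\<bar> * norm u"
    unfolding norm_phase_def scaleR_phase_def distrib_left by simp
qed

end

lemma plane_eq_span: "{Phase 0 y z | y z. True} = span {Phase 0 1 0, Phase 0 0 1}"
proof (intro equalityI subsetI)
  fix u assume "u \<in> {Phase 0 y z | y z. True}"
  then obtain y z where "u = Phase 0 y z" by blast
  then have "u = y *\<^sub>R Phase 0 1 0 + z *\<^sub>R Phase 0 0 1"
    by (simp add: plus_phase_def scaleR_phase_def)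
  then show "u \<in> span {Phase 0 1 0, Phase 0 0 1}"
    by (simp add: span_add span_scale span_base)
next
  have "subspace {Phase 0 y z | y z. True}"
    by (auto simp: subspace_def zero_phase_def plus_phase_def scaleR_phase_def)
  then have "span {Phase 0 1 0, Phase 0 0 1} \<subseteq> {Phase 0 y z | y z. True}"
    by (intro span_minimal) auto
  then show "u \<in> {Phase 0 y z | y z. True}" if "u \<in> span {Phase 0 1 0, Phase 0 0 1}" for u
    using that by blast
qed

section \<open>The semigroup\<close>

lemma flow_integrand_continuous:
  "continuous_on S (\<lambda>s. sinc (x + s) * (y + (t - s) * z))"
  by (rule continuous_on_mult[OF continuous_on_sinc]) (auto intro!: continuous_intros)

lemma abs_sinc_le: "0 < x \<Longrightarrow> \<bar>sinc x\<bar> \<le> 1 / x"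
  by (simp add: divide_right_mono)

lemma flow_fun_mem:
  fixes f :: "real \<Rightarrow> real" and t y z :: real
  assumes f: "continuous_on {0..} f" "(f \<longlongrightarrow> 0) at_top" and t: "0 \<le> t"
  defines "h \<equiv> \<lambda>x. if 0 \<le> t \<and> 0 \<le> x
    then f (x + t) + integral {0..t} (\<lambda>s. sinc (x + s) * (y + (t - s) * z)) else 0"
  shows "continuous_on {0..} h" "(h \<longlongrightarrow> 0) at_top"
proof -
  let ?I = "\<lambda>x. integral {0..t} (\<lambda>s. sinc (x + s) * (y + (t - s) * z))"
  let ?K = "\<bar>y\<bar> + t * \<bar>z\<bar>"
  have "continuous_on ({0..} \<times> cbox 0 t) (\<lambda>(x, s). sinc (x + s) * (y + (t - s) * z))"
    unfolding case_prod_unfold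
    by (rule continuous_on_mult[OF continuous_on_sinc]) (auto intro!: continuous_intros)
  from integral_continuous_on_param[OF this] have cI: "continuous_on {0..} ?I"
    by simp
  have cf: "continuous_on {0..} (\<lambda>x. f (x + t))"
    using t by (intro continuous_on_compose2[OF f(1)]) (auto intro!: continuous_intros)
  have "continuous_on {0..} (\<lambda>x. f (x + t) + ?I x)"
    by (intro continuous_on_add cf cI)
  then show "continuous_on {0..} h"
    by (rule continuous_on_eq) (use t in \<open>auto simp: h_def\<close>)
  have bound: "norm (?I x) \<le> ?K * t / x" if x: "x > 0" for x
  proof -
    have "norm (?I x) \<le> (?K / x) * (t - 0)"
    proof (rule integral_bound[OF t flow_integrand_continuous])
      fix s assume s: "s \<in> {0..t}"
      have "\<bar>y + (t - s) * z\<bar> \<le> \<bar>y\<bar> + \<bar>t - s\<bar> * \<bar>z\<bar>"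
        by (metis abs_mult abs_triangle_ineq)
      also have "\<dots> \<le> ?K"
        using s by (intro add_left_mono mult_right_mono) auto
      finally have 1: "\<bar>y + (t - s) * z\<bar> \<le> ?K" .
      have "\<bar>sinc (x + s)\<bar> \<le> 1 / (x + s)"
        using x s by (intro abs_sinc_le) auto
      also have "\<dots> \<le> 1 / x"
        using x s by (intro frac_le) auto
      finally have 2: "\<bar>sinc (x + s)\<bar> \<le> 1 / x" .
      have "\<bar>sinc (x + s)\<bar> * \<bar>y + (t - s) * z\<bar> \<le> (1 / x) * ?K"
        by (rule mult_mono[OF 2 1]) (use x in auto)
      also have "\<dots> = ?K / x"
        by simp
      finally show "norm (sinc (x + s) * (y + (t - s) * z)) \<le> ?K / x"
        unfolding real_norm_def abs_mult .
    qed
    then show ?thesis by simp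
  qed
  have lim: "((\<lambda>x. ?K * t / x) \<longlongrightarrow> 0) at_top"
    by (intro tendsto_divide_0[OF tendsto_const] filterlim_at_top_imp_at_infinity filterlim_ident)
  have "(?I \<longlongrightarrow> 0) at_top"
    by (rule Lim_null_comparison[OF _ lim])
      (use bound in \<open>auto intro!: eventually_mono[OF eventually_gt_at_top[of 0]]\<close>)
  moreover have "((\<lambda>x. f (x + t)) \<longlongrightarrow> 0) at_top"
    by (rule filterlim_compose[OF f(2)])
      (rule filterlim_tendsto_add_at_top[OF tendsto_const filterlim_ident, of t, unfolded add.commute[of t]])
  ultimately have "((\<lambda>x. f (x + t) + ?I x) \<longlongrightarrow> 0) at_top"
    using tendsto_add[of "\<lambda>x. f (x + t)" 0 at_top ?I 0] by simp
  then show "(h \<longlongrightarrow> 0) at_top"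
    by (rule Lim_transform_eventually)
      (use t in \<open>auto simp: h_def intro!: eventually_mono[OF eventually_ge_at_top[of 0]]\<close>)
qed

text \<open>The value for \<open>t < 0\<close> is a dummy: the semigroup is only defined for \<open>t \<ge> 0\<close>.\<close>

lift_definition flow_fun :: "real \<Rightarrow> c0 \<Rightarrow> real \<Rightarrow> real \<Rightarrow> c0" is
  "\<lambda>t f y z x. if 0 \<le> t \<and> 0 \<le> x
     then f (x + t) + integral {0..t} (\<lambda>s. sinc (x + s) * (y + (t - s) * z)) else 0"
proof -
  fix t y z and f :: "real \<Rightarrow> real"
  let ?h = "\<lambda>x. if 0 \<le> t \<and> 0 \<le> x
     then f (x + t) + integral {0..t} (\<lambda>s. sinc (x + s) * (y + (t - s) * z)) else 0"
  assume f: "continuous_on {0..} f \<and> (f \<longlongrightarrow> 0) at_top \<and> (\<forall>x<0. f x = 0)"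
  show "continuous_on {0..} ?h \<and> (?h \<longlongrightarrow> 0) at_top \<and> (\<forall>x<0. ?h x = 0)"
  proof (cases "0 \<le> t")
    case True
    from f have "continuous_on {0..} f" "(f \<longlongrightarrow> 0) at_top" by auto
    note mem = flow_fun_mem[OF this True, of y z]
    show ?thesis
      by (intro conjI mem) simp
  next
    case False
    then show ?thesis by simp
  qed
qed

definition flow :: "real \<Rightarrow> phase \<Rightarrow> phase" where
  "flow t u = Phase (flow_fun t (fun_part u) (y_part u) (z_part u)) (y_part u + t * z_part u) (z_part u)"

lemma flow_0: "flow 0 u = u"
  by (cases u) (auto simp: flow_def flow_fun.rep_eq intro!: c0_eqI)

lemma flow_add:
  assumes t: "0 \<le> t" and r: "0 \<le> r"
  shows "flow t (flow r u) = flow (t + r) u"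
proof -
  obtain f y z where u: "u = Phase f y z" by (cases u)
  have "flow_fun t (flow_fun r f y z) (y + r * z) z = flow_fun (t + r) f y z"
  proof (rule c0_eqI)
    fix x :: real assume x: "0 \<le> x"
    let ?k = "\<lambda>s. sinc (x + s) * (y + (t + r - s) * z)"
    have int: "?k integrable_on S" if "S = {a..b}" for S a b
      unfolding that by (intro integrable_continuous_interval flow_integrand_continuous)
    have "(\<lambda>s. sinc (x + t + s) * (y + (r - s) * z)) = ?k \<circ> (+) t"
      by (rule ext) (simp add: add.assoc)
    then have 1: "integral {0..r} (\<lambda>s. sinc (x + t + s) * (y + (r - s) * z)) = integral {t..t + r} ?k"
      using integral_shift_Icc_real[of 0 r ?k t] by (simp only: add_0 add.commute[of r t])
    have 2: "integral {0..t} (\<lambda>s. sinc (x + s) * (y + r * z + (t - s) * z)) = integral {0..t} ?k"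
      by (intro integral_cong) (simp add: algebra_simps)
    have "integral {0..t} ?k + integral {t..t + r} ?k = integral {0..t + r} ?k"
      by (rule Henstock_Kurzweil_Integration.integral_combine) (use t r int in auto)
    then have "integral {0..r} (\<lambda>s. sinc (x + t + s) * (y + (r - s) * z))
        + integral {0..t} (\<lambda>s. sinc (x + s) * (y + r * z + (t - s) * z)) = integral {0..t + r} ?k"
      unfolding 1 2 by (simp only: add.commute)
    then show "c0_apply (flow_fun t (flow_fun r f y z) (y + r * z) z) x = c0_apply (flow_fun (t + r) f y z) x"
      unfolding flow_fun.rep_eq using t r x by (simp only: add.assoc add_nonneg_nonneg simp_thms if_True)
  qed
  then show ?thesis
    by (simp add: flow_def u algebra_simps)
qed

section \<open>Angles and almost stabilizable subspaces\<close>

text \<open>The suprema are taken in the complete lattice \<open>[0, \<infinity>]\<close>, so that the supremum of the empty set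
  is \<open>0\<close>; for subspaces the value is at most \<open>1\<close>.\<close>

definition angle :: "'a::real_normed_vector set \<Rightarrow> 'a set \<Rightarrow> ennreal" where
  "angle A B = min (SUP a\<in>{a \<in> A. norm a = 1}. ennreal (infdist a B))
                   (SUP b\<in>{b \<in> B. norm b = 1}. ennreal (infdist b A))"

text \<open>Meant for finite-dimensional subspaces \<open>Y\<close>, with \<open>\<phi> t\<close> defined for \<open>t \<ge> 0\<close>; only large times
  \<open>T\<close> matter.\<close>

definition almost_stabilizable ::
    "(real \<Rightarrow> 'a::real_normed_vector \<Rightarrow> 'a) \<Rightarrow> 'a set \<Rightarrow> bool" where
  "almost_stabilizable \<phi> Y \<longleftrightarrow>
     (\<forall>t::real. ((\<lambda>T. SUP s\<in>{0..<t}. angle (\<phi> T ` Y) (\<phi> (T + s) ` Y)) \<longlongrightarrow> 0) at_top)"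

end

theory Submission
  imports Defs
begin

text \<open>
  Since \<open>y + (T - s) z = (y + T z) - s z\<close>, the subspace \<open>Y\<^sub>T\<close> is the graph of the operator
  \<open>L\<^sub>T (a, b) (x) = \<integral>\<^bsub>0\<^esub>\<^bsup>T\<^esup> sinc (x + s) (a - s b) ds\<close> from the plane to \<open>C\<^sub>0\<close>, where \<open>(a, b)\<close> is the
  position in the plane at time \<open>T\<close>, not at time \<open>0\<close>.  The integrand is elementary up to the sine
  integral (lemma \<open>flow_fun_closed_form\<close>):
  \<open>L\<^sub>T (a, b) (x) = (a + b x) (Si (x + T) - Si x) + b (cos (x + T) - cos x)\<close>.

  The cosine term makes the graphs oscillate for ever.  At \<open>x = 0\<close> the function
  \<open>L\<^sub>T (0, 1)\<close> takes the value \<open>cos T - 1\<close>, so the vectors over \<open>(0, 1)\<close> in \<open>Y\<^sub>T\<close> and \<open>Y\<^sub>S\<close> differ by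
  at least \<open>\<bar>cos T - cos S\<bar>\<close>; as \<open>Si\<close> is bounded, moving to another point of \<open>Y\<^sub>S\<close> gains only a
  constant factor (lemma \<open>slope_vector_far\<close>).  It remains to see that normalising the vector does
  not destroy this estimate, that is, that \<open>L\<^sub>T (0, 1)\<close> is bounded uniformly in \<open>T\<close>
  (lemma \<open>norm_slope_vector_le\<close>).  This holds because the tail of the sine integral decays like
  \<open>1 / x\<close> and so compensates the factor \<open>x\<close> in \<open>L\<^sub>T (0, 1)\<close>.  Hence the angle between \<open>Y\<^sub>T\<close> and
  \<open>Y\<^sub>S\<close> is at least \<open>\<bar>cos T - cos S\<bar> / 25\<close> for large \<open>S\<close> and \<open>T\<close>, and \<open>T = 2 \<pi> n\<close>, \<open>S = T + \<pi>\<close>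
  contradict stabilization.
\<close>

text \<open>The primitive of \<open>sinc (x + s) (a - s b)\<close>, with \<open>a = y + T z\<close> and \<open>b = z\<close>, comes from
  \<open>a - s b = (a + b x) - b (x + s)\<close> and \<open>u sinc u = sin u\<close>.\<close>

lemma flow_fun_closed_form:
  assumes "0 \<le> T" "0 \<le> x"
  shows "c0_apply (flow_fun T 0 y z) x =
    (y + T * z + z * x) * (Si (x + T) - Si x) + z * (cos (x + T) - cos x)"
proof -
  let ?P = "\<lambda>s. (y + T * z + z * x) * Si (x + s) + z * cos (x + s)"
  have regroup: "(y + T * z + z * x) * k + z * (- r) = k * (y + (T - s) * z)"
    if "r = (x + s) * k" for k r s
    unfolding that by (simp add: algebra_simps)
  have deriv: "(?P has_real_derivative sinc (x + s) * (y + (T - s) * z)) (at s within A)" for s A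
  proof -
    have "((\<lambda>s. Si (x + s)) has_real_derivative sinc (x + s) * 1) (at s within A)"
      by (rule DERIV_chain2[OF DERIV_Si]) (auto intro!: derivative_eq_intros)
    then have "(?P has_real_derivative
        (y + T * z + z * x) * sinc (x + s) + z * (- sin (x + s))) (at s within A)"
      by (auto intro!: derivative_eq_intros simp del: sin_zero)
    also have "(y + T * z + z * x) * sinc (x + s) + z * (- sin (x + s)) =
        sinc (x + s) * (y + (T - s) * z)"
      by (rule regroup) simp
    finally show ?thesis .
  qed
  have "((\<lambda>s. sinc (x + s) * (y + (T - s) * z)) has_integral (?P T - ?P 0)) {0..T}"
    using assms deriv
    by (intro fundamental_theorem_of_calculus)
      (auto simp only: has_real_derivative_iff_has_vector_derivative)
  then have "integral {0..T} (\<lambda>s. sinc (x + s) * (y + (T - s) * z)) = ?P T - ?P 0"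
    by (rule integral_unique)
  then show ?thesis
    unfolding flow_fun.rep_eq zero_c0.rep_eq using assms by (simp add: algebra_simps)
qed

text \<open>Integration by parts, in monotonicity form: \<open>Si x + cos x / x\<close> has derivative
  \<open>- cos x / x\<^sup>2\<close>, so adding \<open>1 / x\<close> makes it decreasing and subtracting \<open>1 / x\<close> makes it
  increasing.\<close>

lemma Si_increment_le:
  assumes "0 < x" "x \<le> u"
  shows "\<bar>Si u - Si x\<bar> \<le> 2 / x"
proof -
  have D: "((\<lambda>v. Si v + (cos v + c) / v) has_real_derivative - ((cos v + c) / v\<^sup>2)) (at v)"
    if "x \<le> v" for v c
  proof -
    have v: "v \<noteq> 0" using that assms by auto
    have "((\<lambda>v. Si v + (cos v + c) / v) has_real_derivative
        sinc v + ((- sin v) * v - (cos v + c) * 1) / (v * v)) (at v)"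
      using v by (intro DERIV_add DERIV_Si DERIV_divide) (auto intro!: derivative_eq_intros)
    also have "sinc v + ((- sin v) * v - (cos v + c) * 1) / (v * v) = - ((cos v + c) / v\<^sup>2)"
      using v by (simp add: field_simps power2_eq_square)
    finally show ?thesis .
  qed
  have nonneg: "0 \<le> (cos v + 1) / v\<^sup>2" and nonpos: "(cos v + (- 1)) / v\<^sup>2 \<le> 0" for v :: real
    using cos_ge_minus_one[of v] cos_le_one[of v]
    by (intro divide_nonneg_nonneg divide_nonpos_nonneg zero_le_power2; linarith)+
  have "Si u + (cos u + 1) / u \<le> Si x + (cos x + 1) / x"
    by (rule DERIV_nonpos_imp_nonincreasing[OF assms(2)])
      (use D nonneg in \<open>blast intro: neg_le_0_iff_le[THEN iffD2]\<close>)
  moreover have "Si x + (cos x + (- 1)) / x \<le> Si u + (cos u + (- 1)) / u"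
    by (rule DERIV_nonneg_imp_nondecreasing[OF assms(2)])
      (use D nonpos in \<open>blast intro: neg_0_le_iff_le[THEN iffD2]\<close>)
  moreover have "0 \<le> (cos u + 1) / u" "(cos u + (- 1)) / u \<le> 0"
    using assms cos_ge_minus_one[of u] cos_le_one[of u]
    by (intro divide_nonneg_nonneg divide_nonpos_nonneg; linarith)+
  moreover have "(cos x + 1) / x \<le> 2 / x" "(- 2) / x \<le> (cos x + (- 1)) / x"
    using assms cos_ge_minus_one[of x] cos_le_one[of x] by (intro divide_right_mono; linarith)+
  ultimately show ?thesis
    by linarith
qed

lemma Si_0: "Si 0 = 0"
  by (simp add: Si_def flip: zero_ereal_def)

lemma abs_c0_apply_le_norm: "0 \<le> x \<Longrightarrow> \<bar>c0_apply f x\<bar> \<le> norm f"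
  unfolding norm_c0_def by (intro cSUP_upper c0_bdd) auto

lemma phase_parts_le_norm:
  "norm (fun_part u) \<le> norm u" "\<bar>y_part u\<bar> \<le> norm u" "\<bar>z_part u\<bar> \<le> norm u"
proof -
  have "\<bar>y_part u\<bar> \<le> sqrt ((y_part u)\<^sup>2 + (z_part u)\<^sup>2)" "\<bar>z_part u\<bar> \<le> sqrt ((y_part u)\<^sup>2 + (z_part u)\<^sup>2)"
    by (auto intro: real_le_rsqrt)
  then show "norm (fun_part u) \<le> norm u" "\<bar>y_part u\<bar> \<le> norm u" "\<bar>z_part u\<bar> \<le> norm u"
    using norm_ge_zero[of "fun_part u"] unfolding norm_phase_def by (simp, linarith+)
qed

text \<open>The point of \<open>\<phi>\<^sub>T Y\<close> over \<open>(0, 1)\<close>, where \<open>\<phi>\<^sub>T Y\<close> is seen as a graph over the plane: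
  the plane coordinates at time \<open>T\<close> of the orbit starting in \<open>(- T, 1)\<close> are \<open>(0, 1)\<close>.\<close>

definition slope_vector :: "real \<Rightarrow> phase" where
  "slope_vector T = flow T (Phase 0 (- T) 1)"

lemma slope_vector_eq: "slope_vector T = Phase (flow_fun T 0 (- T) 1) 0 1"
  by (simp add: slope_vector_def flow_def)

lemma norm_slope_vector_le:
  assumes "0 \<le> T"
  shows "norm (slope_vector T) \<le> 5"
proof -
  have "\<bar>c0_apply (flow_fun T 0 (- T) 1) x\<bar> \<le> 4" if x: "0 \<le> x" for x
  proof -
    have "\<bar>x * (Si (x + T) - Si x)\<bar> \<le> 2"
    proof (cases "x = 0")
      case False
      then show ?thesis
        using x Si_increment_le[of x "x + T"] assms by (simp add: abs_mult pos_le_divide_eq mult.commute)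
    qed simp
    moreover have "c0_apply (flow_fun T 0 (- T) 1) x = x * (Si (x + T) - Si x) + (cos (x + T) - cos x)"
      using flow_fun_closed_form[OF assms x, of "- T" 1] by simp
    ultimately show ?thesis
      using cos_le_one[of x] cos_le_one[of "x + T"]
        cos_ge_minus_one[of x] cos_ge_minus_one[of "x + T"]
      by linarith
  qed
  then have "norm (flow_fun T 0 (- T) 1) \<le> 4"
    unfolding norm_c0_def by (intro cSUP_least) auto
  then show ?thesis
    by (simp add: slope_vector_eq norm_phase_def)
qed

text \<open>Comparing function parts at \<open>x = 0\<close> suffices: there the second vector has the value
  \<open>a Si S + z (cos S - 1)\<close>, where \<open>a = y + S z\<close>, with \<open>a\<close> and \<open>1 - z\<close> bounded by the distance.\<close>

lemma slope_vector_far: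
  assumes T: "0 \<le> T" and S: "0 \<le> S" and Si: "\<bar>Si S\<bar> \<le> 2"
  shows "\<bar>cos T - cos S\<bar> / 5 \<le> norm (slope_vector T - flow S (Phase 0 y z))"
proof -
  let ?d = "slope_vector T - flow S (Phase 0 y z)"
  define a where "a = y + S * z"
  have d: "\<bar>a\<bar> \<le> norm ?d" "\<bar>1 - z\<bar> \<le> norm ?d" "\<bar>c0_apply (fun_part ?d) 0\<bar> \<le> norm ?d"
    using phase_parts_le_norm[of ?d] abs_c0_apply_le_norm[of 0 "fun_part ?d"]
    by (simp_all add: slope_vector_eq flow_def minus_phase_def a_def)
  have "c0_apply (fun_part ?d) 0 = cos T - 1 - (a * Si S + z * (cos S - 1))"
    using flow_fun_closed_form[OF T, of 0 "- T" 1] flow_fun_closed_form[OF S, of 0 y z]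
    by (simp add: slope_vector_eq flow_def minus_phase_def minus_c0.rep_eq a_def Si_0)
  then have eq: "cos T - cos S = c0_apply (fun_part ?d) 0 + a * Si S + (1 - z) * (1 - cos S)"
    by (simp add: algebra_simps)
  have "\<bar>a * Si S\<bar> \<le> norm ?d * 2"
    unfolding abs_mult using d(1) Si by (intro mult_mono) auto
  moreover have "\<bar>(1 - z) * (1 - cos S)\<bar> \<le> norm ?d * 2"
    unfolding abs_mult using d(2) cos_ge_minus_one[of S] by (intro mult_mono) auto
  ultimately have "\<bar>cos T - cos S\<bar> \<le> norm ?d + norm ?d * 2 + norm ?d * 2"
    unfolding eq using d(3)
    by (intro order_trans[OF abs_triangle_ineq] add_mono)
  then show ?thesis
    by simp
qed

text \<open>Rescaling \<open>e\<close> to a unit vector costs at most the factor \<open>K\<close>, because \<open>B\<close> is closed under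
  scaling.\<close>

lemma SUP_infdist_unit_ge:
  fixes A B :: "'a::real_normed_vector set"
  assumes A: "\<And>c v. v \<in> A \<Longrightarrow> c *\<^sub>R v \<in> A" and B: "\<And>c v. v \<in> B \<Longrightarrow> c *\<^sub>R v \<in> B"
    and e: "e \<in> A" "e \<noteq> 0" "norm e \<le> K" and "B \<noteq> {}" "0 \<le> \<delta>"
    and far: "\<And>b. b \<in> B \<Longrightarrow> \<delta> \<le> norm (e - b)"
  shows "ennreal (\<delta> / K) \<le> (SUP a\<in>{a \<in> A. norm a = 1}. ennreal (infdist a B))"
proof -
  let ?u = "e /\<^sub>R norm e"
  have "\<delta> / K \<le> infdist ?u B"
    unfolding infdist_notempty[OF \<open>B \<noteq> {}\<close>]
  proof (rule cINF_greatest[OF \<open>B \<noteq> {}\<close>])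
    fix b assume "b \<in> B"
    have "\<delta> / K \<le> \<delta> / norm e"
      using e \<open>0 \<le> \<delta>\<close> by (intro divide_left_mono) (auto intro!: mult_pos_pos intro: less_le_trans[of 0 "norm e"])
    also have "\<dots> \<le> norm (e - norm e *\<^sub>R b) / norm e"
      using far[OF B[OF \<open>b \<in> B\<close>]] by (intro divide_right_mono) auto
    also have "\<dots> = norm ((e - norm e *\<^sub>R b) /\<^sub>R norm e)"
      by (simp add: divide_inverse mult.commute)
    also have "(e - norm e *\<^sub>R b) /\<^sub>R norm e = ?u - b"
      using e by (simp add: scaleR_diff_right)
    finally show "\<delta> / K \<le> dist ?u b"
      by (simp add: dist_norm)
  qed
  moreover have "?u \<in> {a \<in> A. norm a = 1}"
    using e A by auto
  ultimately show ?thesis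
    by (intro SUP_upper2[of ?u] ennreal_leI)
qed

lemma angle_flow_plane_ge:
  assumes T: "0 \<le> T" "\<bar>Si T\<bar> \<le> 2" and S: "0 \<le> S" "\<bar>Si S\<bar> \<le> 2"
  shows "ennreal (\<bar>cos T - cos S\<bar> / 25) \<le>
    angle (flow T ` {Phase 0 y z | y z. True}) (flow S ` {Phase 0 y z | y z. True})"
proof -
  let ?Y = "{Phase 0 y z | y z. True}"
  have cone: "c *\<^sub>R v \<in> flow R ` ?Y" if "v \<in> flow R ` ?Y" "0 \<le> R" for c v R
  proof -
    obtain y z where v: "v = flow R (Phase 0 y z)"
      using \<open>v \<in> flow R ` ?Y\<close> by auto
    have "c *\<^sub>R flow_fun R 0 y z = flow_fun R 0 (c * y) (c * z)"
      by (rule c0_eqI) (use \<open>0 \<le> R\<close> in \<open>simp add: scaleR_c0.rep_eq flow_fun_closed_form algebra_simps\<close>)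
    then have "c *\<^sub>R v = flow R (Phase 0 (c * y) (c * z))"
      by (simp add: v flow_def scaleR_phase_def algebra_simps)
    then show ?thesis by blast
  qed
  have one_sided: "ennreal (\<bar>cos P - cos Q\<bar> / 5 / 5) \<le>
      (SUP a\<in>{a \<in> flow P ` ?Y. norm a = 1}. ennreal (infdist a (flow Q ` ?Y)))"
    if P: "0 \<le> P" and Q: "0 \<le> Q" "\<bar>Si Q\<bar> \<le> 2" for P Q
  proof (rule SUP_infdist_unit_ge)
    show "slope_vector P \<in> flow P ` ?Y"
      unfolding slope_vector_def by blast
    show "slope_vector P \<noteq> 0"
      by (simp add: slope_vector_eq zero_phase_def)
  qed (use cone P Q norm_slope_vector_le slope_vector_far in auto)
  show ?thesis
    unfolding angle_def using one_sided[of T S] one_sided[of S T] T S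
    by (simp add: abs_minus_commute)
qed

theorem mainTheorem7:
  shows "\<not> almost_stabilizable flow {Phase 0 y z | y z. True}"
proof
  let ?Y = "{Phase 0 y z | y z. True}"
  assume "almost_stabilizable flow ?Y"
  then have "((\<lambda>T. SUP s\<in>{0..<4}. angle (flow T ` ?Y) (flow (T + s) ` ?Y)) \<longlongrightarrow> 0) at_top"
    unfolding almost_stabilizable_def by blast
  then have "eventually (\<lambda>T. (SUP s\<in>{0..<4}. angle (flow T ` ?Y) (flow (T + s) ` ?Y))
      < ennreal (2 / 25)) at_top"
    by (rule order_tendstoD) simp
  moreover have "eventually (\<lambda>T. \<bar>Si T\<bar> \<le> 2) at_top"
  proof -
    have "eventually (\<lambda>T. dist (Si T) (pi / 2) < 2 - pi / 2) at_top"
      using pi_less_4 by (intro tendstoD[OF Si_at_top]) simp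
    then show ?thesis
    proof eventually_elim
      case (elim T)
      then show ?case
        using pi_gt_zero pi_less_4 unfolding dist_real_def by linarith
    qed
  qed
  ultimately have "eventually (\<lambda>T. (SUP s\<in>{0..<4}. angle (flow T ` ?Y) (flow (T + s) ` ?Y))
      < ennreal (2 / 25) \<and> \<bar>Si T\<bar> \<le> 2) at_top"
    by (rule eventually_conj)
  then obtain N where "\<forall>T\<ge>N. (SUP s\<in>{0..<4}. angle (flow T ` ?Y) (flow (T + s) ` ?Y))
      < ennreal (2 / 25) \<and> \<bar>Si T\<bar> \<le> 2"
    unfolding eventually_at_top_linorder by (rule exE)
  then have N:
    "N \<le> T \<Longrightarrow> (SUP s\<in>{0..<4}. angle (flow T ` ?Y) (flow (T + s) ` ?Y)) < ennreal (2 / 25)"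
    "N \<le> T \<Longrightarrow> \<bar>Si T\<bar> \<le> 2" for T
    by (rule allE[of _ T], simp)+
  obtain n :: nat where "N < real n * (2 * pi)"
    using reals_Archimedean3[of "2 * pi"] by auto
  define T where "T = 2 * pi * real n"
  have T: "0 \<le> T" "N \<le> T" "cos T = 1"
    using \<open>N < real n * (2 * pi)\<close> cos_2npi[of n] by (simp_all add: T_def mult_ac)
  have "ennreal (2 / 25) = ennreal (\<bar>cos T - cos (T + pi)\<bar> / 25)"
    using T by simp
  also have "\<dots> \<le> angle (flow T ` ?Y) (flow (T + pi) ` ?Y)"
    using T pi_ge_zero by (intro angle_flow_plane_ge N(2)) linarith+
  also have "\<dots> \<le> (SUP s\<in>{0..<4}. angle (flow T ` ?Y) (flow (T + s) ` ?Y))"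
    using pi_less_4 by (intro SUP_upper) auto
  finally show False
    using N(1)[OF \<open>N \<le> T\<close>] by (meson not_le)
qed

end
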